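(* Let $\mathbb{S}^{q-1}$ be the unit sphere in $\mathbb{R}^q$ and let $A\subset\mathbb{S}^{q-1}$ be a nonempty set having box-counting dimension $\operatorname{BCD}(A)$ (that is, the limit defining it exists). Set $$X=\{tx\in\mathbb{R}^q: t\ge 0,\ x\in A\}$$ with the metric inherited from $\mathbb{R}^q$. Let $\lambda>1$ and define $f:X\to X$ by $f(x)=\lambda x$. Then $$h_\infty(f)=(\operatorname{BCD}(A)+1)\log\lambda.$$
   Context: $\mathbb{R}^q$ carries the Euclidean metric, and subsets carry the restricted metric. A subset of a metric space is $\varepsilon$-spanning if for every element of the space there is an element of the subset at distance less than $\varepsilon$. For a bounded metric space $Z$, let $r(Z,\varepsilon)$ be the minimum cardinality of an $\varepsilon$-spanning subset of $Z$. The box-counting dimension of $Z$ is $\operatorname{BCD}(Z)=\lim_{\varepsilon\to0}\frac{\log r(Z,\varepsilon)}{-\log\varepsilon}$, if the limit exists. Coarse entropy: let $(X,d)$ be a nonempty metric space and $f:X\to X$ a map. A $\delta$-pseudoorbit of $f$ of length $n$ starting at $x_0$ is a sequence $(x_0,x_1,\dots,x_n)$ in $X$ with $d(f(x_i),x_{i+1})\le\delta$ for $i=0,\dots,n-1$. The distance between $(x_0,\dots,x_n)$ and $(y_0,\dots,y_n)$ is $\max_{0\le i\le n}d(x_i,y_i)$. A set is $R$-separated if any two distinct elements are at distance at least $R$. Let $s(f,n,R,\delta,x_0)\in[1,\infty]$ be the supremum of cardinalities of $R$-separated sets of $\delta$-pseudoorbits of $f$ of length $n$ starting at $x_0$. The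 coarse entropy of $f$ is $$h_\infty(f)=\lim_{\delta\to\infty}\lim_{R\to\infty}\limsup_{n\to\infty}\frac1n\log s(f,n,R,\delta,x_0)\in[0,\infty];$$ it does not depend on the choice of $x_0\in X$ (and the limits in $R$ and $\delta$ exist by monotonicity). *)

theory Defs
  imports "HOL-Analysis.Analysis"
begin

definition ecard :: "'a set \<Rightarrow> enat" where
  "ecard S = (if finite S then enat (card S) else \<infinity>)"

definition log_enat :: "enat \<Rightarrow> ereal" where
  "log_enat m = (case m of enat k \<Rightarrow> if k = 0 then - \<infinity> else ereal (ln (real k)) | \<infinity> \<Rightarrow> \<infinity>)"

text \<open>A metric space is given by a subset \<open>Z\<close> of a type of class \<open>metric_space\<close>,
  with the restricted metric; spanning sets must lie inside \<open>Z\<close>.\<close>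

definition spanning_in :: "'a::metric_space set \<Rightarrow> real \<Rightarrow> 'a set \<Rightarrow> bool" where
  "spanning_in Z \<epsilon> S \<longleftrightarrow> S \<subseteq> Z \<and> (\<forall>z\<in>Z. \<exists>s\<in>S. dist z s < \<epsilon>)"

text \<open>The infimum is attained, since \<^typ>\<open>enat\<close> is well-ordered and \<open>Z\<close> spans itself
  for \<open>\<epsilon> > 0\<close>.\<close>

definition spanning_number :: "'a::metric_space set \<Rightarrow> real \<Rightarrow> enat" where
  "spanning_number Z \<epsilon> = (INF S\<in>{S. spanning_in Z \<epsilon> S}. ecard S)"

definition box_ratio :: "'a::metric_space set \<Rightarrow> real \<Rightarrow> ereal" where
  "box_ratio Z \<epsilon> = log_enat (spanning_number Z \<epsilon>) / ereal (- ln \<epsilon>)"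

definition has_BCD :: "'a::metric_space set \<Rightarrow> bool" where
  "has_BCD Z \<longleftrightarrow> bounded Z \<and> (\<exists>b. (box_ratio Z \<longlongrightarrow> b) (at_right 0))"

definition BCD :: "'a::metric_space set \<Rightarrow> ereal" where
  "BCD Z = Lim (at_right 0) (box_ratio Z)"

text \<open>A pseudoorbit of length \<open>n\<close> is the list of its \<open>n + 1\<close> points.\<close>

definition pseudoorbits ::
  "'a::metric_space set \<Rightarrow> ('a \<Rightarrow> 'a) \<Rightarrow> nat \<Rightarrow> real \<Rightarrow> 'a \<Rightarrow> 'a list set" where
  "pseudoorbits X f n \<delta> x0 =
     {xs. length xs = n + 1 \<and> set xs \<subseteq> X \<and> xs ! 0 = x0 \<and>
          (\<forall>i<n. dist (f (xs ! i)) (xs ! Suc i) \<le> \<delta>)}"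

definition orbit_dist :: "nat \<Rightarrow> 'a::metric_space list \<Rightarrow> 'a list \<Rightarrow> real" where
  "orbit_dist n xs ys = Max ((\<lambda>i. dist (xs ! i) (ys ! i)) ` {0..n})"

definition separated :: "nat \<Rightarrow> real \<Rightarrow> 'a::metric_space list set \<Rightarrow> bool" where
  "separated n R P \<longleftrightarrow> (\<forall>xs\<in>P. \<forall>ys\<in>P. xs \<noteq> ys \<longrightarrow> R \<le> orbit_dist n xs ys)"

definition sep_number ::
  "'a::metric_space set \<Rightarrow> ('a \<Rightarrow> 'a) \<Rightarrow> nat \<Rightarrow> real \<Rightarrow> real \<Rightarrow> 'a \<Rightarrow> enat" where
  "sep_number X f n R \<delta> x0 =
     (SUP P\<in>{P. P \<subseteq> pseudoorbits X f n \<delta> x0 \<and> separated n R P}. ecard P)"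

definition growth_rate ::
  "'a::metric_space set \<Rightarrow> ('a \<Rightarrow> 'a) \<Rightarrow> real \<Rightarrow> real \<Rightarrow> 'a \<Rightarrow> ereal" where
  "growth_rate X f \<delta> R x0 =
     limsup (\<lambda>n. ereal (1 / real n) * log_enat (sep_number X f n R \<delta> x0))"

text \<open>The base point \<open>x0\<close> is kept as an argument; independence of \<open>x0\<close> is not built into
  the definition. The two limits exist by the monotonicity lemmas below.\<close>

definition coarse_entropy :: "'a::metric_space set \<Rightarrow> ('a \<Rightarrow> 'a) \<Rightarrow> 'a \<Rightarrow> ereal" where
  "coarse_entropy X f x0 =
     Lim at_top (\<lambda>\<delta>::real. Lim at_top (\<lambda>R::real. growth_rate X f \<delta> R x0))"

lemma log_enat_mono: "a \<le> b \<Longrightarrow> log_enat a \<le> log_enat b"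
  by (cases a; cases b) (auto simp: log_enat_def)

lemma growth_rate_mono:
  assumes "\<delta> \<le> \<delta>'" and "R' \<le> R"
  shows "growth_rate X f \<delta> R x0 \<le> growth_rate X f \<delta>' R' x0"
proof -
  have "pseudoorbits X f n \<delta> x0 \<subseteq> pseudoorbits X f n \<delta>' x0" for n
    using assms unfolding pseudoorbits_def by force
  moreover have "separated n R P \<Longrightarrow> separated n R' P" for n and P :: "'a list set"
    using assms unfolding separated_def by force
  ultimately have "sep_number X f n R \<delta> x0 \<le> sep_number X f n R' \<delta>' x0" for n
    unfolding sep_number_def by (intro SUP_subset_mono) blast+
  then show ?thesis
    unfolding growth_rate_def
    by (intro Limsup_mono always_eventually allI ereal_mult_left_mono log_enat_mono) auto
qed

lemma antimono_tendsto_INF: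
  fixes g :: "real \<Rightarrow> ereal"
  assumes "antimono g"
  shows "(g \<longlongrightarrow> (INF R. g R)) at_top"
proof (rule order_tendstoI)
  fix a assume "a < (INF R. g R)"
  then show "eventually (\<lambda>R. a < g R) at_top"
    by (intro always_eventually allI) (metis INF_lower UNIV_I less_le_trans)
next
  fix a assume "(INF R. g R) < a"
  then obtain R0 where "g R0 < a" by (auto simp: INF_less_iff)
  then show "eventually (\<lambda>R. g R < a) at_top"
    unfolding eventually_at_top_linorder using antimonoD[OF assms] by (meson le_less_trans)
qed

lemma mono_tendsto_SUP:
  fixes g :: "real \<Rightarrow> ereal"
  assumes "mono g"
  shows "(g \<longlongrightarrow> (SUP R. g R)) at_top"
proof (rule order_tendstoI)
  fix a assume "(SUP R. g R) < a"
  then show "eventually (\<lambda>R. g R < a) at_top"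
    by (intro always_eventually allI) (metis SUP_upper UNIV_I le_less_trans)
next
  fix a assume "a < (SUP R. g R)"
  then obtain R0 where "a < g R0" by (auto simp: less_SUP_iff)
  then show "eventually (\<lambda>R. a < g R) at_top"
    unfolding eventually_at_top_linorder using assms by (meson monoD less_le_trans)
qed

lemma tendsto_coarse_entropy_R:
  "((\<lambda>R. growth_rate X f \<delta> R x0) \<longlongrightarrow> (INF R. growth_rate X f \<delta> R x0)) at_top"
  by (intro antimono_tendsto_INF antimonoI growth_rate_mono) auto

lemma tendsto_coarse_entropy_delta:
  "((\<lambda>\<delta>. INF R. growth_rate X f \<delta> R x0) \<longlongrightarrow>
      (SUP \<delta>. INF R. growth_rate X f \<delta> R x0)) at_top"
  by (intro mono_tendsto_SUP monoI INF_mono) (use growth_rate_mono in blast)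

lemma coarse_entropy_eq:
  "coarse_entropy X f x0 = (SUP \<delta>. INF R. growth_rate X f \<delta> R x0)"
  unfolding coarse_entropy_def
  by (simp add: tendsto_Lim[OF _ tendsto_coarse_entropy_R]
      tendsto_Lim[OF _ tendsto_coarse_entropy_delta])

end

theory Submission
  imports Defs
begin

text \<open>
  The theorem holds because, up to bounded changes of scale, counting \<open>R\<close>-separated
  pseudoorbits of length \<open>n\<close> amounts to counting \<open>R\<close>-separated points of the cone \<open>X\<close> in a ball
  whose radius is a constant times \<open>lam ^ n\<close>.

  Upper bound (\<open>sep_number_le\<close>): dilation by \<open>lam\<close> is expanding, so two \<open>\<delta>\<close>-pseudoorbits with
  endpoints less than \<open>R\<close> apart stay less than \<open>R\<close> apart at all earlier times, once
  \<open>R \<ge> 2 * \<delta> / (lam - 1)\<close>. Hence \<open>R\<close>-separated pseudoorbits have \<open>R\<close>-separated endpoints, all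
  within distance \<open>C * lam ^ n\<close> of the origin.
  Lower bound (\<open>sep_number_ge\<close>): if \<open>\<delta>\<close> is large compared with the norm of the starting point,
  every \<open>y \<in> X\<close> of norm at most \<open>lam ^ n\<close> is the endpoint of the pseudoorbit that jumps from the
  starting point to \<open>y / lam ^ (n - 1)\<close> and then follows a true orbit along the ray through \<open>y\<close>.
  Since \<open>\<delta>\<close> does not depend on \<open>R\<close>, this survives the limit in \<open>R\<close>.

  In polar coordinates, the largest \<open>R\<close>-separated subsets of the part of the cone in a ball of
  radius \<open>\<rho>\<close> consist, up to constants, of \<open>\<rho> / R\<close> heights in each of \<open>r(A, R / \<rho>)\<close> directions,
  where \<open>r\<close> is the spanning number
  (\<open>card_separated_cone_le\<close>, \<open>separated_cone_exists\<close>). With \<open>\<rho> = lam ^ n\<close> the logarithm of the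
  product, divided by \<open>n\<close>, tends to \<open>(BCD A + 1) * ln lam\<close> (\<open>tendsto_log_spanning_number\<close>).
\<close>

section \<open>Spanning and separated sets of a bounded set\<close>

text \<open>A separated set of maximal cardinality is spanning. The maximum exists because a finite cover
  by balls of radius \<open>\<epsilon> / 2\<close> bounds the cardinality of every \<open>\<epsilon>\<close>-separated set.\<close>

lemma separated_spanning_exists:
  fixes A :: "'a::euclidean_space set"
  assumes "bounded A" and "\<epsilon> > 0"
  obtains S where "finite S" and "spanning_in A \<epsilon> S"
    and "pairwise (\<lambda>x y. \<epsilon> \<le> dist x y) S"
proof -
  define sep where "sep S \<longleftrightarrow> S \<subseteq> A \<and> pairwise (\<lambda>x y. \<epsilon> \<le> dist x y) S" for S
  have "compact (closure A)"
    using assms(1) by (simp add: compact_closure)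
  then obtain K where K: "finite K" "closure A \<subseteq> (\<Union>x\<in>K. ball x (\<epsilon> / 2))"
    using assms(2) half_gt_zero[OF assms(2)] unfolding compact_eq_totally_bounded by blast
  have bound: "finite S \<and> card S \<le> card K" if "sep S" for S
  proof -
    have "\<forall>s\<in>S. \<exists>x\<in>K. dist x s < \<epsilon> / 2"
      using that K(2) closure_subset unfolding sep_def by fastforce
    then obtain g where g: "\<And>s. s \<in> S \<Longrightarrow> g s \<in> K" "\<And>s. s \<in> S \<Longrightarrow> dist (g s) s < \<epsilon> / 2"
      by metis
    have "inj_on g S"
    proof (rule inj_onI, rule ccontr)
      fix s t assume st: "s \<in> S" "t \<in> S" "g s = g t" "s \<noteq> t"
      then have "\<epsilon> \<le> dist s t"
        using that unfolding sep_def pairwise_def by blast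
      moreover have "dist s t \<le> dist (g s) s + dist (g t) t"
        using st(3) dist_triangle3[of s t "g s"] by simp
      ultimately show False
        using g(2)[OF st(1)] g(2)[OF st(2)] by linarith
    qed
    then show ?thesis
      using g(1) K(1) by (meson card_inj_on_le image_subsetI inj_on_finite)
  qed
  have "sep {}" by (simp add: sep_def)
  then obtain S where S: "sep S" and max: "\<And>T. sep T \<Longrightarrow> card T \<le> card S"
    using ex_has_greatest_nat[of sep "{}" card "card K + 1"] bound
    by (metis add.commute le_imp_less_Suc plus_1_eq_Suc)
  have "\<exists>s\<in>S. dist z s < \<epsilon>" if z: "z \<in> A" for z
  proof (rule ccontr)
    assume "\<not> ?thesis"
    then have far: "\<And>s. s \<in> S \<Longrightarrow> \<epsilon> \<le> dist z s" by force
    then have "z \<notin> S" using assms(2) by force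
    have "sep (insert z S)"
      using S z far unfolding sep_def pairwise_insert by (auto simp: dist_commute)
    then have "card (insert z S) \<le> card S" by (rule max)
    then show False
      using \<open>z \<notin> S\<close> bound[OF S] by simp
  qed
  then have "spanning_in A \<epsilon> S"
    using S unfolding spanning_in_def sep_def by blast
  then show ?thesis
    using that[of S] bound[OF S] S unfolding sep_def by blast
qed

lemma spanning_number_attained:
  fixes A :: "'a::euclidean_space set"
  assumes "bounded A" and "A \<noteq> {}" and "\<epsilon> > 0"
  obtains S where "finite S" and "spanning_in A \<epsilon> S"
    and "spanning_number A \<epsilon> = enat (card S)" and "card S \<ge> 1"
proof -
  obtain T where T: "finite T" "spanning_in A \<epsilon> T"
    using separated_spanning_exists[OF assms(1,3)] by metis
  let ?I = "ecard ` {S. spanning_in A \<epsilon> S}"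
  have "ecard T \<in> ?I" using T(2) by blast
  then have "Inf ?I \<in> ?I"
    by (rule wellorder_InfI)
  then obtain S where S: "spanning_in A \<epsilon> S" "spanning_number A \<epsilon> = ecard S"
    unfolding spanning_number_def by auto
  have "ecard S \<le> ecard T"
    unfolding S(2)[symmetric] spanning_number_def using T(2) by (intro INF_lower) simp
  then have "finite S"
    using T(1) by (auto simp: ecard_def split: if_splits)
  moreover have "S \<noteq> {}"
    using S(1) assms(2) unfolding spanning_in_def by blast
  ultimately show ?thesis
    using that[of S] S by (simp add: ecard_def Suc_le_eq card_gt_0_iff)
qed

lemma spanning_number_le_card:
  assumes "finite S" and "spanning_in A \<epsilon> S"
  shows "spanning_number A \<epsilon> \<le> enat (card S)"
proof -
  have "spanning_number A \<epsilon> \<le> ecard S"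
    unfolding spanning_number_def using assms(2) by (intro INF_lower) simp
  then show ?thesis using assms(1) by (simp add: ecard_def)
qed

section \<open>Separated points in a truncated cone\<close>

text \<open>The cone over \<open>A\<close> with vertex at the origin.\<close>

definition cone_over :: "'a::real_normed_vector set \<Rightarrow> 'a set" where
  "cone_over A = {t *\<^sub>R x | t x. t \<ge> 0 \<and> x \<in> A}"

lemma dist_scaleR_same: "dist (c *\<^sub>R a) (c *\<^sub>R b) = \<bar>c\<bar> * dist a b"
  for a b :: "'a::real_normed_vector"
  unfolding dist_norm by (simp flip: scaleR_diff_right)

lemma dist_scaleR_unit:
  fixes a b :: "'a::real_normed_vector"
  assumes "norm a = 1"  "0 \<le> t" "0 \<le> u"
  shows "dist (t *\<^sub>R a) (u *\<^sub>R b) \<le> \<bar>t - u\<bar> + u * dist a b"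
proof -
  have "t *\<^sub>R a - u *\<^sub>R b = (t - u) *\<^sub>R a + u *\<^sub>R (a - b)"
    by (simp add: algebra_simps)
  then show ?thesis
    using norm_triangle_ineq[of "(t - u) *\<^sub>R a" "u *\<^sub>R (a - b)"] assms
    by (simp add: dist_norm)
qed

lemma card_separated_cone_le:
  fixes A :: "'a::real_normed_vector set"
  assumes "A \<subseteq> sphere 0 1" and "R > 0" and "\<rho> > 0"
    and S: "finite S" "spanning_in A (R / (4 * \<rho>)) S"
    and E: "E \<subseteq> cone_over A" "E \<subseteq> cball 0 \<rho>" "pairwise (\<lambda>x y. R \<le> dist x y) E"
  shows "finite E \<and> card E \<le> (nat \<lfloor>4 * \<rho> / R\<rfloor> + 1) * card S"
proof -
  have "\<forall>y\<in>E. \<exists>t a. 0 \<le> t \<and> a \<in> A \<and> y = t *\<^sub>R a"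
    using E(1) unfolding cone_over_def by blast
  then obtain t a where ta: "\<And>y. y \<in> E \<Longrightarrow> 0 \<le> t y" "\<And>y. y \<in> E \<Longrightarrow> a y \<in> A"
    "\<And>y. y \<in> E \<Longrightarrow> y = t y *\<^sub>R a y"
    by metis
  have unit: "norm (a y) = 1" if "y \<in> E" for y
    using ta(2)[OF that] assms(1) by (auto simp: dist_norm)
  have tle: "t y \<le> \<rho>" if "y \<in> E" for y
  proof -
    have "norm (t y *\<^sub>R a y) \<le> \<rho>" using E(2) ta(3)[OF that] that by (metis mem_cball_0 subsetD)
    then show ?thesis using unit[OF that] ta(1)[OF that] by simp
  qed
  have "\<forall>y\<in>E. \<exists>s\<in>S. dist (a y) s < R / (4 * \<rho>)"
    using ta(2) S(2) unfolding spanning_in_def by blast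
  then obtain s where s: "\<And>y. y \<in> E \<Longrightarrow> s y \<in> S"
    "\<And>y. y \<in> E \<Longrightarrow> dist (a y) (s y) < R / (4 * \<rho>)"
    by metis
  \<comment> \<open>A cell of the partition: a height interval of length \<open>R / 4\<close> and a nearby direction from \<open>S\<close>.\<close>
  define c where "c y = (nat \<lfloor>4 * t y / R\<rfloor>, s y)" for y
  have "inj_on c E"
  proof (rule inj_onI, rule ccontr)
    fix x y assume xy: "x \<in> E" "y \<in> E" "c x = c y" "x \<noteq> y"
    have "0 \<le> 4 * t x / R" "0 \<le> 4 * t y / R"
      using ta(1) xy assms(2) by auto
    then have "\<lfloor>4 * t x / R\<rfloor> = \<lfloor>4 * t y / R\<rfloor>"
      using xy(3) by (simp add: c_def eq_nat_nat_iff)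
    then have "\<bar>4 * t x / R - 4 * t y / R\<bar> < 1" by linarith
    moreover have "4 * t x / R - 4 * t y / R = (t x - t y) / (R / 4)"
      by (simp add: diff_divide_distrib right_diff_distrib mult.commute)
    ultimately have "\<bar>(t x - t y) / (R / 4)\<bar> < 1" by (simp only:)
    then have h: "\<bar>t x - t y\<bar> < R / 4"
      using assms(2) unfolding abs_divide by (subst (asm) divide_less_eq_1_pos) auto
    have "dist (a x) (a y) \<le> dist (a x) (s x) + dist (a y) (s y)"
      using xy(3) dist_triangle2[of "a x" "a y" "s x"] by (simp add: c_def)
    then have "dist (a x) (a y) \<le> 2 * (R / (4 * \<rho>))"
      using s(2)[OF xy(1)] s(2)[OF xy(2)] by linarith
    then have "t y * dist (a x) (a y) \<le> \<rho> * (2 * (R / (4 * \<rho>)))"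
      using tle[OF xy(2)] ta(1)[OF xy(2)] assms(3) by (intro mult_mono) auto
    then have "t y * dist (a x) (a y) \<le> R / 2"
      using assms(3) by simp
    then have "dist x y < R"
      using dist_scaleR_unit[OF unit[OF xy(1)] ta(1)[OF xy(1)] ta(1)[OF xy(2)], of "a y"]
        ta(3)[OF xy(1)] ta(3)[OF xy(2)] h assms(2) by simp
    then show False
      using E(3) xy unfolding pairwise_def by force
  qed
  moreover have sub: "c ` E \<subseteq> {..nat \<lfloor>4 * \<rho> / R\<rfloor>} \<times> S"
  proof -
    have "nat \<lfloor>4 * t y / R\<rfloor> \<le> nat \<lfloor>4 * \<rho> / R\<rfloor>" if "y \<in> E" for y
      using tle[OF that] assms(2) by (intro nat_mono floor_mono divide_right_mono) auto
    then show ?thesis using s(1) unfolding c_def by auto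
  qed
  moreover have fin: "finite ({..nat \<lfloor>4 * \<rho> / R\<rfloor>} \<times> S)" using S(1) by simp
  ultimately have "finite E" "card E \<le> card ({..nat \<lfloor>4 * \<rho> / R\<rfloor>} \<times> S)"
    by (meson inj_on_finite, meson card_inj_on_le)
  then show ?thesis by (simp add: card_cartesian_product)
qed

lemma separated_cone_exists:
  fixes A :: "'a::euclidean_space set"
  assumes "A \<subseteq> sphere 0 1" and "R > 0" and "2 * R \<le> \<rho>"
    and N: "spanning_number A (4 * R / \<rho>) = enat N"
  obtains E where "finite E" "E \<subseteq> cone_over A" "E \<subseteq> cball 0 \<rho>"
    "pairwise (\<lambda>x y. R \<le> dist x y) E" "\<rho> / (2 * R) * real N \<le> real (card E)"
proof -
  have "\<rho> > 0" using assms by linarith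
  have "bounded A" using assms(1) bounded_sphere bounded_subset by blast
  then obtain S where S: "finite S" "spanning_in A (4 * R / \<rho>) S"
    "pairwise (\<lambda>x y. 4 * R / \<rho> \<le> dist x y) S"
    using separated_spanning_exists[of A "4 * R / \<rho>"] \<open>\<rho> > 0\<close> \<open>R > 0\<close> by auto
  have NS: "N \<le> card S"
    using spanning_number_le_card[OF S(1,2)] N by simp
  \<comment> \<open>The heights \<open>k * R\<close>, \<open>m \<le> k \<le> 2 * m\<close>, all lie between \<open>\<rho> / 4\<close> and \<open>\<rho>\<close>.\<close>
  define m where "m = nat \<lfloor>\<rho> / (2 * R)\<rfloor>"
  have "1 \<le> \<rho> / (2 * R)" using assms by (simp add: field_simps)
  then have m: "real m \<le> \<rho> / (2 * R)" "\<rho> / (2 * R) \<le> real m + 1"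
    unfolding m_def by linarith+
  have "1 \<le> m"
    using \<open>1 \<le> \<rho> / (2 * R)\<close> unfolding m_def by linarith
  then have m': "\<rho> / (2 * R) \<le> 2 * real m"
    using m(2) by linarith
  have "real m * (2 * R) \<le> \<rho>" "\<rho> \<le> 2 * real m * (2 * R)"
    using m(1) m' \<open>R > 0\<close> by (simp_all add: field_simps)
  then have lo: "\<rho> / 4 \<le> real k * R" and hi: "real k * R \<le> \<rho>" if "k \<in> {m..2 * m}" for k
  proof -
    have "real m * R \<le> real k * R" "real k * R \<le> real (2 * m) * R"
      using that \<open>R > 0\<close> by (auto intro!: mult_right_mono)
    then show "\<rho> / 4 \<le> real k * R" "real k * R \<le> \<rho>"
      using \<open>real m * (2 * R) \<le> \<rho>\<close> \<open>\<rho> \<le> 2 * real m * (2 * R)\<close> by auto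
  qed
  define g where "g = (\<lambda>(k, a). (real k * R) *\<^sub>R (a :: 'a))"
  have unit: "norm a = 1" if "a \<in> S" for a
    using that S(2) assms(1) unfolding spanning_in_def by (auto simp: dist_norm)
  have sep: "R \<le> dist (g (k, a)) (g (l, b))"
    if k: "k \<in> {m..2 * m}" "a \<in> S" "l \<in> {m..2 * m}" "b \<in> S" "(k, a) \<noteq> (l, b)" for k l a b
  proof (cases "k = l")
    case True
    have "4 * R / \<rho> \<le> dist a b"
      using True k S(3) unfolding pairwise_def by blast
    then have "\<rho> / 4 * (4 * R / \<rho>) \<le> real k * R * dist a b"
      using lo[OF k(1)] \<open>\<rho> > 0\<close> \<open>R > 0\<close> by (intro mult_mono) auto
    moreover have "dist (g (k, a)) (g (l, b)) = real k * R * dist a b"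
      using True \<open>R > 0\<close> by (simp add: g_def dist_scaleR_same)
    ultimately show ?thesis using \<open>\<rho> > 0\<close> by simp
  next
    case False
    then have "1 \<le> \<bar>real k - real l\<bar>" by linarith
    then have "R \<le> \<bar>real k - real l\<bar> * R" using \<open>R > 0\<close> by simp
    also have "\<dots> = \<bar>real k * R - real l * R\<bar>"
      using \<open>R > 0\<close> by (simp add: abs_mult flip: left_diff_distrib)
    also have "\<dots> \<le> norm (g (k, a) - g (l, b))"
      using norm_triangle_ineq3[of "g (k, a)" "g (l, b)"] unit[OF k(2)] unit[OF k(4)] \<open>R > 0\<close>
      by (simp add: g_def)
    finally show ?thesis by (simp add: dist_norm)
  qed
  let ?D = "{m..2 * m} \<times> S"
  have inj: "inj_on g ?D"
  proof (rule inj_onI, clarify)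
    fix k a l b assume "k \<in> {m..2 * m}" "a \<in> S" "l \<in> {m..2 * m}" "b \<in> S" "g (k, a) = g (l, b)"
    then show "k = l \<and> a = b" using sep[of k a l b] \<open>R > 0\<close> by auto
  qed
  show ?thesis
  proof
    show "finite (g ` ?D)" using S(1) by simp
    show "g ` ?D \<subseteq> cone_over A"
      using S(2) \<open>R > 0\<close> unfolding g_def cone_over_def spanning_in_def by fastforce
    show "g ` ?D \<subseteq> cball 0 \<rho>"
    proof
      fix y assume "y \<in> g ` ?D"
      then obtain k a where ka: "k \<in> {m..2 * m}" "a \<in> S" "y = g (k, a)" by blast
      then show "y \<in> cball 0 \<rho>"
        using hi[OF ka(1)] unit[OF ka(2)] \<open>R > 0\<close> by (simp add: g_def)
    qed
    show "pairwise (\<lambda>x y. R \<le> dist x y) (g ` ?D)"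
      unfolding pairwise_def using sep by fastforce
    have "card (g ` ?D) = (m + 1) * card S"
      using inj by (simp add: card_image card_cartesian_product)
    moreover have "\<rho> / (2 * R) * real N \<le> (real m + 1) * real (card S)"
      using m(2) NS \<open>\<rho> > 0\<close> \<open>R > 0\<close> by (intro mult_mono) auto
    ultimately show "\<rho> / (2 * R) * real N \<le> real (card (g ` ?D))"
      by (simp add: distrib_right)
  qed
qed

section \<open>Pseudoorbits of a dilation\<close>

lemma norm_pseudoorbit_le:
  fixes X :: "'a::real_normed_vector set"
  assumes "1 < lam" and f: "\<And>x. x \<in> X \<Longrightarrow> f x = lam *\<^sub>R x"
    and xs: "xs \<in> pseudoorbits X f n \<delta> x0" and "i \<le> n"
  shows "norm (xs ! i) \<le> (norm x0 + \<delta> / (lam - 1)) * lam ^ i - \<delta> / (lam - 1)"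
  using \<open>i \<le> n\<close>
proof (induction i)
  case 0
  then show ?case using xs by (simp add: pseudoorbits_def)
next
  case (Suc i)
  let ?c = "\<delta> / (lam - 1)"
  have "xs ! i \<in> X" "dist (f (xs ! i)) (xs ! Suc i) \<le> \<delta>"
    using xs Suc.prems by (auto simp: pseudoorbits_def intro!: subsetD[OF _ nth_mem])
  then have "norm (xs ! Suc i) \<le> lam * norm (xs ! i) + \<delta>"
    using f[of "xs ! i"] norm_triangle_ineq2[of "xs ! Suc i" "lam *\<^sub>R (xs ! i)"] \<open>1 < lam\<close>
    by (simp add: dist_norm norm_minus_commute)
  also have "\<dots> \<le> lam * ((norm x0 + ?c) * lam ^ i - ?c) + \<delta>"
    using Suc \<open>1 < lam\<close> by simp
  also have "\<dots> = (norm x0 + ?c) * lam ^ Suc i - (lam * ?c - \<delta>)"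
    by (simp add: algebra_simps)
  also have "lam * ?c - \<delta> = ?c"
    using \<open>1 < lam\<close> by (simp add: field_simps)
  finally show ?case .
qed

text \<open>Endpoints control the whole pseudoorbit, because one step backwards contracts distances by
  the factor \<open>lam\<close> up to an error \<open>2 * \<delta>\<close>.\<close>

lemma dist_pseudoorbits_less:
  fixes X :: "'a::real_normed_vector set"
  assumes "1 < lam" and f: "\<And>x. x \<in> X \<Longrightarrow> f x = lam *\<^sub>R x"
    and xs: "xs \<in> pseudoorbits X f n \<delta> x0" and ys: "ys \<in> pseudoorbits X f n \<delta> x0"
    and R: "2 * \<delta> / (lam - 1) \<le> R"
    and last: "dist (xs ! n) (ys ! n) < R" and "i \<le> n"
  shows "dist (xs ! i) (ys ! i) < R"
  using \<open>i \<le> n\<close>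
proof (induction rule: inc_induct)
  case base
  show ?case by (fact last)
next
  case (step i)
  have x: "xs ! i \<in> X" "dist (f (xs ! i)) (xs ! Suc i) \<le> \<delta>"
    using xs step by (auto simp: pseudoorbits_def intro!: subsetD[OF _ nth_mem])
  have y: "ys ! i \<in> X" "dist (f (ys ! i)) (ys ! Suc i) \<le> \<delta>"
    using ys step by (auto simp: pseudoorbits_def intro!: subsetD[OF _ nth_mem])
  have "lam * dist (xs ! i) (ys ! i) = dist (f (xs ! i)) (f (ys ! i))"
    using \<open>1 < lam\<close> f[OF x(1)] f[OF y(1)] dist_scaleR_same[of lam "xs ! i" "ys ! i"] by simp
  also have "\<dots> \<le> dist (f (xs ! i)) (xs ! Suc i) + dist (xs ! Suc i) (ys ! Suc i)
      + dist (f (ys ! i)) (ys ! Suc i)"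
    using dist_triangle[of "f (xs ! i)" "f (ys ! i)" "xs ! Suc i"]
      dist_triangle2[of "xs ! Suc i" "f (ys ! i)" "ys ! Suc i"] by linarith
  also have "\<dots> < R + 2 * \<delta>"
    using x(2) y(2) step.IH by linarith
  also have "\<dots> \<le> lam * R"
    using R \<open>1 < lam\<close> by (simp add: field_simps)
  finally show ?case using \<open>1 < lam\<close> by simp
qed

lemma dist_nth_le_orbit_dist: "i \<le> n \<Longrightarrow> dist (xs ! i) (ys ! i) \<le> orbit_dist n xs ys"
  unfolding orbit_dist_def by (intro Max_ge) auto

lemma sep_number_le:
  fixes A :: "'a::euclidean_space set"
  assumes "A \<subseteq> sphere 0 1" and "A \<noteq> {}" and "1 < lam"
    and f: "\<And>x. x \<in> cone_over A \<Longrightarrow> f x = lam *\<^sub>R x"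
    and "0 < \<delta>" and "0 < R" and R: "2 * \<delta> / (lam - 1) \<le> R"
    and C: "C = norm x0 + \<delta> / (lam - 1)"
    and N: "spanning_number A (R / (4 * C) / lam ^ n) = enat N"
  shows "sep_number (cone_over A) f n R \<delta> x0 \<le> enat ((nat \<lfloor>4 * C / R * lam ^ n\<rfloor> + 1) * N)"
proof -
  define \<rho> where "\<rho> = C * lam ^ n"
  have "0 < C"
    unfolding C using \<open>0 < \<delta>\<close> \<open>1 < lam\<close> by (intro add_nonneg_pos) auto
  then have "0 < \<rho>" using \<open>1 < lam\<close> by (simp add: \<rho>_def)
  have eps: "R / (4 * C) / lam ^ n = R / (4 * \<rho>)" by (simp add: \<rho>_def)
  have "bounded A" using assms(1) bounded_sphere bounded_subset by blast
  then obtain S where S: "finite S" "spanning_in A (R / (4 * \<rho>)) S" "N = card S"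
    using spanning_number_attained[of A "R / (4 * \<rho>)"] N \<open>A \<noteq> {}\<close> \<open>0 < R\<close> \<open>0 < \<rho>\<close>
    unfolding eps by auto
  have "ecard P \<le> enat ((nat \<lfloor>4 * C / R * lam ^ n\<rfloor> + 1) * N)"
    if P: "P \<subseteq> pseudoorbits (cone_over A) f n \<delta> x0" "separated n R P" for P
  proof -
    have far: "R \<le> dist (xs ! n) (ys ! n)" if "xs \<in> P" "ys \<in> P" "xs \<noteq> ys" for xs ys
    proof (rule ccontr)
      assume "\<not> ?thesis"
      then have *: "dist (xs ! n) (ys ! n) < R" by simp
      have "dist (xs ! i) (ys ! i) < R" if "i \<le> n" for i
        by (rule dist_pseudoorbits_less[OF \<open>1 < lam\<close> f _ _ R * that])
          (use \<open>xs \<in> P\<close> \<open>ys \<in> P\<close> P(1) in auto)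
      then have "orbit_dist n xs ys < R"
        unfolding orbit_dist_def by (subst Max_less_iff) auto
      then show False using P(2) that unfolding separated_def by force
    qed
    have inj: "inj_on (\<lambda>xs. xs ! n) P"
      using far \<open>0 < R\<close> by (intro inj_onI) (metis dist_self not_less)
    let ?E = "(\<lambda>xs. xs ! n) ` P"
    have "finite ?E \<and> card ?E \<le> (nat \<lfloor>4 * \<rho> / R\<rfloor> + 1) * card S"
    proof (rule card_separated_cone_le[OF assms(1) \<open>0 < R\<close> \<open>0 < \<rho>\<close> S(1,2)])
      show "?E \<subseteq> cone_over A"
        using P(1) by (force simp: pseudoorbits_def intro!: subsetD[OF _ nth_mem])
      have "norm (xs ! n) \<le> \<rho>" if "xs \<in> P" for xs
      proof -
        have "norm (xs ! n) \<le> C * lam ^ n - \<delta> / (lam - 1)"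
          unfolding C using that P(1) by (intro norm_pseudoorbit_le[OF \<open>1 < lam\<close> f]) auto
        moreover have "0 \<le> \<delta> / (lam - 1)" using \<open>0 < \<delta>\<close> \<open>1 < lam\<close> by simp
        ultimately show ?thesis unfolding \<rho>_def by linarith
      qed
      then show "?E \<subseteq> cball 0 \<rho>" by auto
      show "pairwise (\<lambda>x y. R \<le> dist x y) ?E"
        using far unfolding pairwise_def by fastforce
    qed
    moreover have "4 * \<rho> / R = 4 * C / R * lam ^ n" by (simp add: \<rho>_def)
    ultimately show ?thesis
      using inj S(3) by (simp add: ecard_def card_image finite_image_iff)
  qed
  then show ?thesis
    unfolding sep_number_def by (intro SUP_least) blast
qed

lemma radial_pseudoorbit:
  fixes A :: "'a::real_normed_vector set"
  assumes "1 < lam" and f: "\<And>x. x \<in> cone_over A \<Longrightarrow> f x = lam *\<^sub>R x"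
    and "x0 \<in> cone_over A" and y: "y \<in> cone_over A" "norm y \<le> lam ^ n" and "0 < n"
  shows "map (\<lambda>i. if i = 0 then x0 else (1 / lam ^ (n - i)) *\<^sub>R y) [0..<n + 1]
    \<in> pseudoorbits (cone_over A) f n (lam * norm x0 + lam) x0"
proof -
  define z where "z i = (if i = 0 then x0 else (1 / lam ^ (n - i)) *\<^sub>R y)" for i :: nat
  have scale: "c *\<^sub>R y \<in> cone_over A" if "0 \<le> c" for c
  proof -
    obtain t a where "0 \<le> t" "a \<in> A" "y = t *\<^sub>R a" using y(1) unfolding cone_over_def by blast
    then show ?thesis
      unfolding cone_over_def using that by (auto intro!: exI[of _ "c * t"])
  qed
  have z0: "z 0 = x0" by (simp add: z_def)
  have z: "z i \<in> cone_over A" for i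
    using assms scale by (simp add: z_def)
  have "dist (f (z i)) (z (Suc i)) \<le> lam * norm x0 + lam" if "i < n" for i
  proof (cases "i = 0")
    case True
    have "norm (z (Suc 0)) = norm y / lam ^ (n - 1)"
      using \<open>1 < lam\<close> by (simp add: z_def)
    also have "\<dots> \<le> lam ^ n / lam ^ (n - 1)"
      using y(2) \<open>1 < lam\<close> by (intro divide_right_mono) auto
    also have "\<dots> = lam"
      using \<open>0 < n\<close> \<open>1 < lam\<close> by (cases n) auto
    finally have "norm (z (Suc 0)) \<le> lam" .
    moreover have "norm (f (z 0)) = lam * norm x0"
      using f[OF z[of 0]] \<open>1 < lam\<close> by (simp add: z_def)
    ultimately show ?thesis
      using True norm_triangle_ineq4[of "f (z 0)" "z (Suc 0)"] by (simp add: dist_norm)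
  next
    case False
    have "lam ^ (n - i) = lam * lam ^ (n - Suc i)"
      using that by (simp add: Suc_diff_Suc flip: power_Suc)
    then have "f (z i) = z (Suc i)"
      using f[OF z[of i]] False \<open>1 < lam\<close> by (simp add: z_def)
    then show ?thesis using \<open>1 < lam\<close> by simp
  qed
  then have "map z [0..<n + 1] \<in> pseudoorbits (cone_over A) f n (lam * norm x0 + lam) x0"
    unfolding pseudoorbits_def using z by (auto simp: z0 nth_append simp del: upt_Suc)
  then show ?thesis by (simp add: z_def[abs_def] del: upt_Suc)
qed

lemma sep_number_ge:
  fixes A :: "'a::euclidean_space set"
  assumes "A \<subseteq> sphere 0 1" and "1 < lam"
    and f: "\<And>x. x \<in> cone_over A \<Longrightarrow> f x = lam *\<^sub>R x"
    and "x0 \<in> cone_over A" and "0 < R" and "2 * R \<le> lam ^ n" and "0 < n"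
    and N: "spanning_number A (4 * R / lam ^ n) = enat N"
  obtains M where "1 / (2 * R) * lam ^ n * real N \<le> real M"
    and "enat M \<le> sep_number (cone_over A) f n R (lam * norm x0 + lam) x0"
proof -
  obtain E where E: "finite E" "E \<subseteq> cone_over A" "E \<subseteq> cball 0 (lam ^ n)"
    "pairwise (\<lambda>x y. R \<le> dist x y) E" "lam ^ n / (2 * R) * real N \<le> real (card E)"
    using separated_cone_exists[OF assms(1) \<open>0 < R\<close> \<open>2 * R \<le> lam ^ n\<close> N] by metis
  define h where "h y = map (\<lambda>i. if i = 0 then x0 else (1 / lam ^ (n - i)) *\<^sub>R y) [0..<n + 1]"
    for y :: 'a
  have hn: "h y ! n = y" for y
    using \<open>0 < n\<close> by (simp add: h_def nth_append)
  then have inj: "inj_on h E" by (metis inj_onI)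
  have "h y \<in> pseudoorbits (cone_over A) f n (lam * norm x0 + lam) x0" if "y \<in> E" for y
    unfolding h_def using that E assms by (intro radial_pseudoorbit) auto
  moreover have "separated n R (h ` E)"
    unfolding separated_def
  proof (intro ballI impI)
    fix xs ys assume "xs \<in> h ` E" "ys \<in> h ` E" "xs \<noteq> ys"
    then obtain x y where "x \<in> E" "y \<in> E" "x \<noteq> y" "xs = h x" "ys = h y" by blast
    then have "R \<le> dist (xs ! n) (ys ! n)"
      using E(4) hn by (simp add: pairwise_def)
    then show "R \<le> orbit_dist n xs ys"
      using dist_nth_le_orbit_dist[of n n xs ys] by simp
  qed
  ultimately have "ecard (h ` E) \<le> sep_number (cone_over A) f n R (lam * norm x0 + lam) x0"
    unfolding sep_number_def by (intro SUP_upper) auto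
  then show ?thesis
    using that[of "card E"] E(1,5) inj by (simp add: ecard_def card_image)
qed

section \<open>The exponential growth rate\<close>

text \<open>With \<open>\<epsilon> = c / lam ^ n\<close>, the logarithm splits into \<open>box_ratio A \<epsilon> * (- ln \<epsilon>)\<close>, coming from
  the directions, and \<open>ln (d * lam ^ n)\<close>, coming from the heights; both \<open>- ln \<epsilon> / n\<close> and
  \<open>ln (d * lam ^ n) / n\<close> tend to \<open>ln lam\<close>. The limit \<open>b\<close> is extended real, so \<open>0 \<le> b\<close> is needed for
  distributivity.\<close>

lemma tendsto_log_spanning_number:
  fixes N :: "real \<Rightarrow> nat"
  assumes "1 < lam" and "0 < c" and "0 < d"
    and N: "\<And>\<epsilon>. 0 < \<epsilon> \<Longrightarrow> spanning_number A \<epsilon> = enat (N \<epsilon>)" "\<And>\<epsilon>. 0 < \<epsilon> \<Longrightarrow> 1 \<le> N \<epsilon>"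
    and lim: "(box_ratio A \<longlongrightarrow> b) (at_right 0)"
  shows "(\<lambda>n. ereal (1 / real n * ln (d * lam ^ n * real (N (c / lam ^ n)))))
    \<longlonglongrightarrow> (b + 1) * ereal (ln lam)"
proof -
  have "0 < ln lam" using \<open>1 < lam\<close> by simp
  define \<epsilon> where "\<epsilon> n = c / lam ^ n" for n
  have pos: "0 < \<epsilon> n" for n using assms(1,2) by (simp add: \<epsilon>_def)
  have "\<epsilon> \<longlonglongrightarrow> 0"
    using tendsto_mult[OF tendsto_const[of c] LIMSEQ_inverse_realpow_zero[OF \<open>1 < lam\<close>]]
    by (simp add: \<epsilon>_def[abs_def] divide_inverse)
  then have \<epsilon>0: "filterlim \<epsilon> (at_right 0) sequentially"
    using pos by (auto simp: filterlim_at less_imp_neq[THEN not_sym] intro!: always_eventually)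
  have r: "(\<lambda>n. box_ratio A (\<epsilon> n)) \<longlonglongrightarrow> b"
    using filterlim_compose[OF lim \<epsilon>0] .
  have small: "\<forall>\<^sub>F n in sequentially. \<epsilon> n < 1"
    using order_tendstoD(2)[OF \<open>\<epsilon> \<longlonglongrightarrow> 0\<close>, of 1] by simp
  have box: "box_ratio A (\<epsilon> n) = ereal (ln (N (\<epsilon> n)) / - ln (\<epsilon> n))" if "\<epsilon> n < 1" for n
  proof -
    have "ln (\<epsilon> n) < 0" using that pos[of n] by simp
    then show ?thesis
      using N(1)[OF pos[of n]] N(2)[OF pos[of n]] by (simp add: box_ratio_def log_enat_def)
  qed
  have "0 \<le> b"
  proof (rule tendsto_lowerbound[OF r])
    show "\<forall>\<^sub>F n in sequentially. 0 \<le> box_ratio A (\<epsilon> n)"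
      using small
    proof eventually_elim
      case (elim n)
      have "ln (\<epsilon> n) < 0" "0 \<le> ln (real (N (\<epsilon> n)))"
        using elim pos[of n] N(2)[OF pos[of n]] by simp_all
      then show ?case unfolding box[OF elim] by (simp add: divide_le_0_iff)
    qed
  qed simp
  have lns: "(\<lambda>n. - ln (\<epsilon> n) / real n) \<longlonglongrightarrow> ln lam"
  proof -
    have "(\<lambda>n. ln lam - ln c / real n) \<longlonglongrightarrow> ln lam - 0"
      by (intro tendsto_intros lim_const_over_n)
    moreover have "\<forall>\<^sub>F n in sequentially. ln lam - ln c / real n = - ln (\<epsilon> n) / real n"
      using eventually_gt_at_top[of 0]
      by eventually_elim (use assms(1,2) in \<open>simp add: \<epsilon>_def ln_div ln_realpow field_simps\<close>)
    ultimately show ?thesis by (simp add: tendsto_cong)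
  qed
  have lnd: "(\<lambda>n. ln (d * lam ^ n) / real n) \<longlonglongrightarrow> ln lam"
  proof -
    have "(\<lambda>n. ln lam + ln d / real n) \<longlonglongrightarrow> ln lam + 0"
      by (intro tendsto_intros lim_const_over_n)
    moreover have "\<forall>\<^sub>F n in sequentially. ln lam + ln d / real n = ln (d * lam ^ n) / real n"
      using eventually_gt_at_top[of 0]
      by eventually_elim (use assms(1,3) in \<open>simp add: ln_mult ln_realpow field_simps\<close>)
    ultimately show ?thesis by (simp add: tendsto_cong)
  qed
  have "(\<lambda>n. box_ratio A (\<epsilon> n) * ereal (- ln (\<epsilon> n) / real n)) \<longlonglongrightarrow> b * ereal (ln lam)"
    using r lns \<open>0 < ln lam\<close> by (intro tendsto_mult_ereal) auto
  then have "(\<lambda>n. box_ratio A (\<epsilon> n) * ereal (- ln (\<epsilon> n) / real n) + ereal (ln (d * lam ^ n) / real n))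
      \<longlonglongrightarrow> b * ereal (ln lam) + ereal (ln lam)"
    using lnd by (intro tendsto_add_ereal_general1) auto
  moreover have "b * ereal (ln lam) + ereal (ln lam) = (b + 1) * ereal (ln lam)"
    using \<open>0 \<le> b\<close> \<open>0 < ln lam\<close> by (simp add: ereal_left_distrib)
  moreover have "\<forall>\<^sub>F n in sequentially.
      box_ratio A (\<epsilon> n) * ereal (- ln (\<epsilon> n) / real n) + ereal (ln (d * lam ^ n) / real n)
      = ereal (1 / real n * ln (d * lam ^ n * real (N (c / lam ^ n))))"
    using small
  proof eventually_elim
    case (elim n)
    have "ln (\<epsilon> n) < 0" using elim pos[of n] by simp
    moreover have "ln (d * lam ^ n * real (N (\<epsilon> n))) = ln (d * lam ^ n) + ln (real (N (\<epsilon> n)))"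
      using N(2)[OF pos[of n]] assms(1,3) by (subst ln_mult) auto
    ultimately show ?case
      unfolding box[OF elim] by (simp add: add_divide_distrib add.commute flip: \<epsilon>_def)
  qed
  ultimately show ?thesis by (simp add: tendsto_cong)
qed

lemma log_enat_enat: "1 \<le> k \<Longrightarrow> log_enat (enat k) = ereal (ln (real k))"
  by (simp add: log_enat_def)

theorem mainTheorem3:
  fixes A X :: "(real ^ 'q) set" and lam :: real and f :: "real ^ 'q \<Rightarrow> real ^ 'q"
    and x0 :: "real ^ 'q"
  assumes "A \<subseteq> sphere 0 1" and "A \<noteq> {}" and "has_BCD A"
    and "X = {t *\<^sub>R x | t x. t \<ge> 0 \<and> x \<in> A}"
    and "lam > 1"
    and "\<And>x. x \<in> X \<Longrightarrow> f x = lam *\<^sub>R x"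
    and "x0 \<in> X"
  shows "coarse_entropy X f x0 = (BCD A + 1) * ereal (ln lam)"
proof -
  have X: "X = cone_over A" using assms(4) by (simp add: cone_over_def)
  have f: "\<And>x. x \<in> cone_over A \<Longrightarrow> f x = lam *\<^sub>R x" and x0: "x0 \<in> cone_over A"
    using assms(6,7) X by auto
  have lim: "(box_ratio A \<longlongrightarrow> BCD A) (at_right 0)"
    using assms(3) unfolding has_BCD_def BCD_def by (metis tendsto_Lim trivial_limit_at_right_real)
  have "bounded A" using assms(3) by (simp add: has_BCD_def)
  then have "\<forall>\<epsilon>. \<exists>k. 0 < \<epsilon> \<longrightarrow> spanning_number A \<epsilon> = enat k \<and> 1 \<le> k"
    using spanning_number_attained[OF _ assms(2)] by metis
  then obtain N where N: "\<And>\<epsilon>. 0 < \<epsilon> \<Longrightarrow> spanning_number A \<epsilon> = enat (N \<epsilon>)"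
    "\<And>\<epsilon>. 0 < \<epsilon> \<Longrightarrow> 1 \<le> N \<epsilon>"
    by metis
  have upper: "(INF R. growth_rate X f \<delta> R x0) \<le> (BCD A + 1) * ereal (ln lam)" for \<delta>
  proof -
    define \<delta>' where "\<delta>' = max \<delta> 1"
    define R where "R = max 1 (2 * \<delta>' / (lam - 1))"
    define C where "C = norm x0 + \<delta>' / (lam - 1)"
    define d where "d = 4 * C / R + 1"
    have "0 < \<delta>'" "0 < R" by (simp_all add: \<delta>'_def R_def)
    then have "0 < C" unfolding C_def using \<open>lam > 1\<close> by (intro add_nonneg_pos) auto
    then have "0 < d" unfolding d_def using \<open>0 < R\<close> by (simp add: add_pos_pos)
    have "0 < R / (4 * C)" using \<open>0 < R\<close> \<open>0 < C\<close> by simp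
    have "log_enat (sep_number X f n R \<delta>' x0)
        \<le> ereal (ln (d * lam ^ n * real (N (R / (4 * C) / lam ^ n))))" for n
    proof -
      let ?N = "N (R / (4 * C) / lam ^ n)" and ?k = "nat \<lfloor>4 * C / R * lam ^ n\<rfloor> + 1"
      have e: "0 < R / (4 * C) / lam ^ n"
        using \<open>0 < R\<close> \<open>0 < C\<close> \<open>lam > 1\<close> by simp
      have "sep_number X f n R \<delta>' x0 \<le> enat (?k * ?N)"
        unfolding X using e assms(1,2,5) \<open>0 < \<delta>'\<close> \<open>0 < R\<close> f
        by (intro sep_number_le[where C = C and lam = lam] N) (auto simp: R_def C_def)
      then have "log_enat (sep_number X f n R \<delta>' x0) \<le> log_enat (enat (?k * ?N))"
        by (rule log_enat_mono)
      also have "\<dots> = ereal (ln (real (?k * ?N)))"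
        using N(2)[OF e] by (intro log_enat_enat) simp
      also have "\<dots> \<le> ereal (ln (d * lam ^ n * real ?N))"
      proof -
        have "1 \<le> lam ^ n" using \<open>lam > 1\<close> by simp
        moreover have "0 \<le> 4 * C / R * lam ^ n" using \<open>0 < C\<close> \<open>0 < R\<close> \<open>lam > 1\<close> by simp
        then have "real ?k \<le> 4 * C / R * lam ^ n + 1" by linarith
        ultimately have "real ?k \<le> d * lam ^ n" unfolding d_def distrib_right by linarith
        then have "real (?k * ?N) \<le> d * lam ^ n * real ?N"
          unfolding of_nat_mult by (intro mult_right_mono) auto
        moreover have "0 < ?k * ?N" using N(2)[OF e] by (intro mult_pos_pos) linarith+
        then have "0 < real (?k * ?N)" by (simp only: of_nat_0_less_iff)
        ultimately show ?thesis by (simp only: ereal_less_eq ln_mono)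
      qed
      finally show ?thesis .
    qed
    then have "ereal (1 / real n) * log_enat (sep_number X f n R \<delta>' x0)
        \<le> ereal (1 / real n * ln (d * lam ^ n * real (N (R / (4 * C) / lam ^ n))))" for n
      unfolding times_ereal.simps(1)[symmetric] by (intro ereal_mult_left_mono) auto
    then have "growth_rate X f \<delta>' R x0 \<le>
        limsup (\<lambda>n. ereal (1 / real n * ln (d * lam ^ n * real (N (R / (4 * C) / lam ^ n)))))"
      unfolding growth_rate_def by (intro Limsup_mono always_eventually allI)
    also have "\<dots> = (BCD A + 1) * ereal (ln lam)"
      by (intro lim_imp_Limsup tendsto_log_spanning_number[OF _ _ _ N lim])
        (use \<open>lam > 1\<close> \<open>0 < R / (4 * C)\<close> \<open>0 < d\<close> in auto)
    finally have "growth_rate X f \<delta>' R x0 \<le> (BCD A + 1) * ereal (ln lam)" .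
    moreover have "growth_rate X f \<delta> R x0 \<le> growth_rate X f \<delta>' R x0"
      by (intro growth_rate_mono) (auto simp: \<delta>'_def)
    ultimately show ?thesis
      by (meson INF_lower2 UNIV_I order_trans)
  qed
  \<comment> \<open>Large enough to jump from \<open>x0\<close> to any point of norm at most \<open>lam\<close>, whatever \<open>R\<close> is.\<close>
  define \<delta> where "\<delta> = lam * norm x0 + lam"
  have lower: "(BCD A + 1) * ereal (ln lam) \<le> growth_rate X f \<delta> R x0" for R
  proof -
    define R' where "R' = max R 1"
    have "0 < R'" by (simp add: R'_def)
    have "\<forall>\<^sub>F n in sequentially. 2 * R' \<le> lam ^ n \<and> 0 < n"
    proof -
      have "filterlim (\<lambda>n. lam ^ n) at_top sequentially"
        using filterlim_at_infinity_imp_norm_at_top[OF filterlim_realpow_sequentially_gt1[of lam]]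
          \<open>lam > 1\<close> by (simp add: norm_power)
      then show ?thesis
        by (auto simp: filterlim_at_top intro: eventually_conj eventually_gt_at_top)
    qed
    then have ev: "\<forall>\<^sub>F n in sequentially.
        ereal (1 / real n * ln (1 / (2 * R') * lam ^ n * real (N (4 * R' / lam ^ n))))
        \<le> ereal (1 / real n) * log_enat (sep_number X f n R' \<delta> x0)"
    proof eventually_elim
      case (elim n)
      let ?N = "N (4 * R' / lam ^ n)"
      have e: "0 < 4 * R' / lam ^ n" using \<open>0 < R'\<close> \<open>lam > 1\<close> by simp
      obtain M where M: "1 / (2 * R') * lam ^ n * real ?N \<le> real M"
        "enat M \<le> sep_number X f n R' \<delta> x0"
        using sep_number_ge[OF assms(1,5) f x0 \<open>0 < R'\<close> _ _ N(1)[OF e]] elim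
        unfolding X \<delta>_def by metis
      have pos: "0 < 1 / (2 * R') * lam ^ n * real ?N"
        using N(2)[OF e] \<open>0 < R'\<close> \<open>lam > 1\<close> by simp
      then have "1 \<le> M" using M(1) by linarith
      have "ereal (ln (1 / (2 * R') * lam ^ n * real ?N)) \<le> ereal (ln (real M))"
        using pos M(1) by (simp only: ereal_less_eq ln_mono)
      also have "\<dots> \<le> log_enat (sep_number X f n R' \<delta> x0)"
        using log_enat_mono[OF M(2)] log_enat_enat[OF \<open>1 \<le> M\<close>] by simp
      finally show ?case
        unfolding times_ereal.simps(1)[symmetric] by (intro ereal_mult_left_mono) auto
    qed
    have "(BCD A + 1) * ereal (ln lam) =
        limsup (\<lambda>n. ereal (1 / real n * ln (1 / (2 * R') * lam ^ n * real (N (4 * R' / lam ^ n)))))"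
      by (intro lim_imp_Limsup[symmetric] tendsto_log_spanning_number[OF _ _ _ N lim])
        (use \<open>lam > 1\<close> \<open>0 < R'\<close> in auto)
    also have "\<dots> \<le> growth_rate X f \<delta> R' x0"
      unfolding growth_rate_def using ev by (rule Limsup_mono)
    also have "\<dots> \<le> growth_rate X f \<delta> R x0"
      by (intro growth_rate_mono) (auto simp: R'_def)
    finally show ?thesis .
  qed
  show ?thesis
    unfolding coarse_entropy_eq
  proof (rule antisym)
    show "(SUP \<delta>. INF R. growth_rate X f \<delta> R x0) \<le> (BCD A + 1) * ereal (ln lam)"
      using upper by (rule SUP_least)
    have "(BCD A + 1) * ereal (ln lam) \<le> (INF R. growth_rate X f \<delta> R x0)"
      using lower by (rule INF_greatest)
    then show "(BCD A + 1) * ereal (ln lam) \<le> (SUP \<delta>. INF R. growth_rate X f \<delta> R x0)"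
      by (rule SUP_upper2[OF UNIV_I])
  qed
qed

end
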